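(* Let $X$ be a normed space and $C\subset X$ a cone such that $\overline{C^*-C^*}=X^*$ (norm closure in $X^*$). If $0_X$ is a point of continuity for $C$, then $\mathrm{qi}\,C^*\neq\emptyset$.
   Context: Normed spaces are real and not assumed complete; $0_X$ is the origin. A cone is a nonempty convex subset $C\subset X$ with $\alpha C\subset C$ for all real $\alpha\ge0$ (not assumed closed). The dual cone is $C^*=\{f\in X^*: f(c)\ge0\ \forall c\in C\}$. The origin $0_X$ is a point of continuity for $C$ if the identity map $(C,\text{weak})\to(C,\|\cdot\|)$ is continuous at $0_X$. Given a cone $K$ in a normed space $Y$, ordered by $x\le y\Leftrightarrow y-x\in K$ and with order intervals $[x,y]=\{z\in Y: x\le z\le y\}$, an element $k\in K$ is a quasi-interior point if $\overline{\bigcup_{n\ge1}[-nk,nk]}=Y$ (norm closure); $\mathrm{qi}\,K$ is the set of all quasi-interior points. Here $\mathrm{qi}\,C^*$ is this set for $K=C^*$, $Y=X^*$. *)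

theory Defs
  imports "HOL-Analysis.Analysis"
begin

definition weak_topology :: "'a::real_normed_vector topology"
  where "weak_topology =
    topology_generated_by {blinfun_apply f -` U | (f :: 'a \<Rightarrow>\<^sub>L real) U. open U}"

definition point_of_continuity :: "'a::real_normed_vector set \<Rightarrow> 'a \<Rightarrow> bool"
  where "point_of_continuity C x \<longleftrightarrow>
    topcontinuous_at (subtopology weak_topology C) (subtopology euclidean C) id x"

definition dual_cone :: "'a::real_normed_vector set \<Rightarrow> ('a \<Rightarrow>\<^sub>L real) set"
  where "dual_cone C = {f. \<forall>c\<in>C. blinfun_apply f c \<ge> 0}"

definition cone_le :: "'a::ab_group_add set \<Rightarrow> 'a \<Rightarrow> 'a \<Rightarrow> bool"
  where "cone_le K x y \<longleftrightarrow> y - x \<in> K"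

definition order_interval :: "'a::ab_group_add set \<Rightarrow> 'a \<Rightarrow> 'a \<Rightarrow> 'a set"
  where "order_interval K x y = {z. cone_le K x z \<and> cone_le K z y}"

definition quasi_interior :: "'a::real_normed_vector set \<Rightarrow> 'a set"
  where "quasi_interior K =
    {k \<in> K. closure (\<Union>n\<in>{1::nat..}. order_interval K (- (real n *\<^sub>R k)) (real n *\<^sub>R k)) = UNIV}"

end

theory Submission
  imports Defs
begin

text \<open>
  A weak neighbourhood of the origin is controlled by finitely many functionals, and a cone is
  invariant under positive scaling. Weak-to-norm continuity at the origin therefore says that the
  norm is dominated on \<open>C\<close> by a finite sum \<open>\<Sum>f\<in>F. \<bar>f c\<bar>\<close>, up to a constant
  (\<open>norm_le_sum_functionals_on_cone\<close>).

  The functionals in \<open>F\<close> need not be positive. Since \<open>C\<^sup>* - C\<^sup>*\<close> is dense, each of them is a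
  difference \<open>p - q\<close> with \<open>p\<close>, \<open>q\<close> in \<open>C\<^sup>*\<close> up to a small error, and on \<open>C\<close> one has
  \<open>\<bar>p - q\<bar> \<le> p + q\<close>. The errors together amount to at most half of the norm term being estimated
  and can be absorbed into it, so a single \<open>g\<close> in \<open>C\<^sup>*\<close>, namely the sum of all the \<open>p + q\<close>, dominates
  the norm on \<open>C\<close> (\<open>dual_cone_element_dominating_norm\<close>).

  Such a \<open>g\<close> is more than quasi-interior: each functional \<open>h\<close> satisfies
  \<open>\<bar>h c\<bar> \<le> norm h * norm c \<le> n * g c\<close> on \<open>C\<close> for some \<open>n\<close> that does not depend on \<open>c\<close>, so
  the intervals \<open>[-n g, n g]\<close> already cover the dual space before the closure is taken
  (\<open>dominating_norm_imp_quasi_interior\<close>).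
\<close>

lemma weak_neighbourhood_of_zero:
  fixes U :: "'a::real_normed_vector set"
  assumes "openin weak_topology U" and "0 \<in> U"
  obtains F :: "('a \<Rightarrow>\<^sub>L real) set" and \<delta> :: real
  where "finite F" and "\<delta> > 0" and "{x. \<forall>f\<in>F. \<bar>blinfun_apply f x\<bar> < \<delta>} \<subseteq> U"
proof -
  define S :: "'a set set"
    where "S = {blinfun_apply f -` U | (f :: 'a \<Rightarrow>\<^sub>L real) U. open U}"
  have "generate_topology_on S U"
    using assms(1) unfolding weak_topology_def S_def openin_topology_generated_by_iff .
  then have "0 \<in> U \<longrightarrow> (\<exists>(F :: ('a \<Rightarrow>\<^sub>L real) set) \<delta>. finite F \<and> \<delta> > 0
      \<and> {x. \<forall>f\<in>F. \<bar>blinfun_apply f x\<bar> < \<delta>} \<subseteq> U)"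
  proof induction
    case Empty
    then show ?case by simp
  next
    case (Int A B)
    show ?case
    proof
      assume "0 \<in> A \<inter> B"
      then obtain F G :: "('a \<Rightarrow>\<^sub>L real) set" and d e where
        "finite F" "d > 0" "{x. \<forall>f\<in>F. \<bar>blinfun_apply f x\<bar> < d} \<subseteq> A"
        "finite G" "e > 0" "{x. \<forall>f\<in>G. \<bar>blinfun_apply f x\<bar> < e} \<subseteq> B"
        using Int.IH by auto
      then show "\<exists>(F :: ('a \<Rightarrow>\<^sub>L real) set) \<delta>. finite F \<and> \<delta> > 0
          \<and> {x. \<forall>f\<in>F. \<bar>blinfun_apply f x\<bar> < \<delta>} \<subseteq> A \<inter> B"
        by (intro exI[of _ "F \<union> G"] exI[of _ "min d e"]) auto
    qed
  next
    case (UN K)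
    show ?case
    proof
      assume "0 \<in> \<Union>K"
      then obtain k where "k \<in> K" "0 \<in> k" by blast
      with UN.IH[of k] obtain F :: "('a \<Rightarrow>\<^sub>L real) set" and d where
        "finite F" "d > 0" and sub: "{x. \<forall>f\<in>F. \<bar>blinfun_apply f x\<bar> < d} \<subseteq> k"
        by auto
      moreover have "{x. \<forall>f\<in>F. \<bar>blinfun_apply f x\<bar> < d} \<subseteq> \<Union>K"
        using sub \<open>k \<in> K\<close> by (rule order_trans[OF _ Union_upper])
      ultimately show "\<exists>(F :: ('a \<Rightarrow>\<^sub>L real) set) \<delta>. finite F \<and> \<delta> > 0
          \<and> {x. \<forall>f\<in>F. \<bar>blinfun_apply f x\<bar> < \<delta>} \<subseteq> \<Union>K"
        by (intro exI conjI)
    qed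
  next
    case (Basis s)
    then obtain f :: "'a \<Rightarrow>\<^sub>L real" and V where s: "s = blinfun_apply f -` V" and "open V"
      unfolding S_def by blast
    show ?case
    proof
      assume "0 \<in> s"
      then have "0 \<in> V" using s by simp
      with \<open>open V\<close> obtain e where e: "e > 0" "ball 0 e \<subseteq> V"
        using open_contains_ball by blast
      have "{x. \<forall>f\<in>{f}. \<bar>blinfun_apply f x\<bar> < e} \<subseteq> s"
        using e(2) s by (auto simp: subset_iff dist_real_def)
      then show "\<exists>(F :: ('a \<Rightarrow>\<^sub>L real) set) \<delta>. finite F \<and> \<delta> > 0
          \<and> {x. \<forall>f\<in>F. \<bar>blinfun_apply f x\<bar> < \<delta>} \<subseteq> s"
        using e(1) by blast
    qed
  qed
  with assms(2) that show thesis by blast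
qed

text \<open>
  Normalise a point of the cone that violates the bound: the result is a unit vector of \<open>C\<close> on
  which all functionals in \<open>F\<close> are small, whereas continuity forces such vectors into the open
  unit ball.
\<close>

lemma norm_le_sum_functionals_on_cone:
  fixes C :: "'a::real_normed_vector set"
  assumes "cone C" and "point_of_continuity C 0"
  obtains F :: "('a \<Rightarrow>\<^sub>L real) set" and \<delta> :: real
  where "finite F" and "\<delta> > 0" and "\<And>c. c \<in> C \<Longrightarrow> \<delta> * norm c \<le> (\<Sum>f\<in>F. \<bar>blinfun_apply f c\<bar>)"
proof -
  have cont: "topcontinuous_at (subtopology weak_topology C) (subtopology euclidean C) id 0"
    using assms(2) unfolding point_of_continuity_def .
  then have "0 \<in> C" unfolding topcontinuous_at_def by simp
  have "openin (subtopology euclidean C) (C \<inter> ball 0 1)"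
    by (simp add: openin_open_Int)
  moreover have "\<forall>V. openin (subtopology euclidean C) V \<and> id 0 \<in> V \<longrightarrow>
      (\<exists>W. openin (subtopology weak_topology C) W \<and> 0 \<in> W \<and> (\<forall>y\<in>W. id y \<in> V))"
    using cont unfolding topcontinuous_at_def by (elim conjE)
  moreover have "id 0 \<in> C \<inter> ball 0 1" using \<open>0 \<in> C\<close> by simp
  ultimately have "\<exists>W. openin (subtopology weak_topology C) W \<and> 0 \<in> W
      \<and> (\<forall>y\<in>W. id y \<in> C \<inter> ball 0 1)"
    by blast
  then obtain W where W: "openin (subtopology weak_topology C) W" "0 \<in> W"
    and W_ball: "\<And>y. y \<in> W \<Longrightarrow> y \<in> ball 0 1"
    by auto
  from W obtain U where U: "openin weak_topology U" "W = U \<inter> C"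
    unfolding openin_subtopology by blast
  then have "0 \<in> U" using W(2) by blast
  obtain F :: "('a \<Rightarrow>\<^sub>L real) set" and \<delta> where F: "finite F" and \<delta>: "\<delta> > 0"
    and sub: "{x. \<forall>f\<in>F. \<bar>blinfun_apply f x\<bar> < \<delta>} \<subseteq> U"
    by (rule weak_neighbourhood_of_zero[OF U(1) \<open>0 \<in> U\<close>])
  have "\<delta> * norm c \<le> (\<Sum>f\<in>F. \<bar>blinfun_apply f c\<bar>)" if "c \<in> C" for c
  proof (rule ccontr)
    assume "\<not> ?thesis"
    then have less: "(\<Sum>f\<in>F. \<bar>blinfun_apply f c\<bar>) < \<delta> * norm c" by simp
    moreover have "0 \<le> (\<Sum>f\<in>F. \<bar>blinfun_apply f c\<bar>)" by (simp add: sum_nonneg)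
    ultimately have pos: "norm c > 0"
      using \<delta> by (metis le_less_trans zero_less_mult_pos)
    define u where "u = (1 / norm c) *\<^sub>R c"
    have "u \<in> C" using assms(1) that unfolding cone_def u_def by simp
    have "\<bar>blinfun_apply f u\<bar> < \<delta>" if "f \<in> F" for f
    proof -
      have "\<bar>blinfun_apply f c\<bar> \<le> (\<Sum>f\<in>F. \<bar>blinfun_apply f c\<bar>)"
        using F that by (intro member_le_sum) auto
      then have "\<bar>blinfun_apply f c\<bar> < \<delta> * norm c" using less by simp
      then show ?thesis
        using pos by (simp add: u_def blinfun.scaleR_right field_simps)
    qed
    then have "u \<in> W" using sub U(2) \<open>u \<in> C\<close> by blast
    then have "norm u < 1" using W_ball by fastforce
    moreover have "norm u = 1" using pos by (simp add: u_def)
    ultimately show False by simp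
  qed
  with F \<delta> that show thesis by blast
qed

lemma dual_cone_add:
  "f \<in> dual_cone C \<Longrightarrow> g \<in> dual_cone C \<Longrightarrow> f + g \<in> dual_cone C"
  unfolding dual_cone_def by (simp add: blinfun.add_left)

lemma dual_cone_sum:
  "(\<And>i. i \<in> I \<Longrightarrow> f i \<in> dual_cone C) \<Longrightarrow> (\<Sum>i\<in>I. f i) \<in> dual_cone C"
  unfolding dual_cone_def by (auto simp: blinfun.sum_left intro!: sum_nonneg)

text \<open>
  Only finitely many functionals have to be approximated, so the tolerance can be chosen in advance
  such that the accumulated error costs no more than half of the constant \<open>\<delta>\<close>.
\<close>

lemma dual_cone_element_dominating_norm:
  fixes C :: "'a::real_normed_vector set" and F :: "('a \<Rightarrow>\<^sub>L real) set"
  assumes dense: "closure {f - g | f g. f \<in> dual_cone C \<and> g \<in> dual_cone C} = UNIV"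
    and F: "finite F" and \<delta>: "\<delta> > 0"
    and bound: "\<And>c. c \<in> C \<Longrightarrow> \<delta> * norm c \<le> (\<Sum>f\<in>F. \<bar>blinfun_apply f c\<bar>)"
  obtains g where "g \<in> dual_cone C" and "\<And>c. c \<in> C \<Longrightarrow> \<delta> / 2 * norm c \<le> g c"
proof -
  \<comment> \<open>The approximation errors must add up to at most \<open>\<delta> / 2\<close>; the successor covers empty \<open>F\<close>.\<close>
  define \<epsilon> where "\<epsilon> = \<delta> / (2 * real (Suc (card F)))"
  have "\<epsilon> > 0" using \<delta> by (simp add: \<epsilon>_def)
  have total_error: "real (card F) * \<epsilon> \<le> \<delta> / 2"
    using \<delta> by (simp add: \<epsilon>_def field_simps)
  have "\<exists>p q. p \<in> dual_cone C \<and> q \<in> dual_cone C \<and> norm (f - (p - q)) < \<epsilon>"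
    for f :: "'a \<Rightarrow>\<^sub>L real"
  proof -
    have "f \<in> closure {f - g | f g. f \<in> dual_cone C \<and> g \<in> dual_cone C}"
      using dense by simp
    then obtain y where "y \<in> {f - g | f g. f \<in> dual_cone C \<and> g \<in> dual_cone C}"
      and "dist y f < \<epsilon>"
      using \<open>\<epsilon> > 0\<close> unfolding closure_approachable by blast
    then show ?thesis by (auto simp: dist_norm norm_minus_commute)
  qed
  then obtain p q where p: "\<And>f. p f \<in> dual_cone C" and q: "\<And>f. q f \<in> dual_cone C"
    and approx: "\<And>f :: 'a \<Rightarrow>\<^sub>L real. norm (f - (p f - q f)) < \<epsilon>"
    by metis
  define g where "g = (\<Sum>f\<in>F. p f + q f)"
  have "g \<in> dual_cone C"
    unfolding g_def by (intro dual_cone_sum dual_cone_add p q)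
  moreover have "\<delta> / 2 * norm c \<le> g c" if c: "c \<in> C" for c
  proof -
    have "\<bar>blinfun_apply f c\<bar> \<le> (p f + q f) c + \<epsilon> * norm c" for f :: "'a \<Rightarrow>\<^sub>L real"
    proof -
      have "\<bar>(f - (p f - q f)) c\<bar> \<le> norm (f - (p f - q f)) * norm c"
        using norm_blinfun[of "f - (p f - q f)" c] by simp
      also have "\<dots> \<le> \<epsilon> * norm c"
        using approx[of f] by (intro mult_right_mono) auto
      finally have "\<bar>f c - (p f c - q f c)\<bar> \<le> \<epsilon> * norm c"
        by (simp add: blinfun.diff_left)
      moreover have "0 \<le> p f c" "0 \<le> q f c"
        using p q c unfolding dual_cone_def by auto
      ultimately show ?thesis by (simp add: blinfun.add_left)
    qed
    then have "(\<Sum>f\<in>F. \<bar>blinfun_apply f c\<bar>) \<le> (\<Sum>f\<in>F. (p f + q f) c + \<epsilon> * norm c)"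
      by (intro sum_mono)
    also have "\<dots> = g c + real (card F) * \<epsilon> * norm c"
      by (simp add: g_def sum.distrib blinfun.sum_left blinfun.add_left)
    also have "\<dots> \<le> g c + \<delta> / 2 * norm c"
      using total_error by (intro add_left_mono mult_right_mono) auto
    finally show ?thesis using bound[OF c] by simp
  qed
  ultimately show thesis using that by blast
qed

lemma dominating_norm_imp_quasi_interior:
  fixes C :: "'a::real_normed_vector set"
  assumes g: "g \<in> dual_cone C" and r: "r > 0"
    and bound: "\<And>c. c \<in> C \<Longrightarrow> r * norm c \<le> g c"
  shows "g \<in> quasi_interior (dual_cone C)"
proof -
  have "h \<in> (\<Union>n\<in>{1::nat..}. order_interval (dual_cone C) (- (real n *\<^sub>R g)) (real n *\<^sub>R g))"
    for h :: "'a \<Rightarrow>\<^sub>L real"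
  proof -
    obtain m :: nat where "norm h / r \<le> real m"
      using real_arch_simple by blast
    then have n: "norm h \<le> real (Suc m) * r"
      using r by (simp add: field_simps)
    have "\<bar>h c\<bar> \<le> real (Suc m) * g c" if c: "c \<in> C" for c
    proof -
      have "\<bar>h c\<bar> \<le> norm h * norm c" using norm_blinfun[of h c] by simp
      also have "\<dots> \<le> real (Suc m) * r * norm c"
        using n by (intro mult_right_mono) auto
      also have "\<dots> \<le> real (Suc m) * g c"
        using mult_left_mono[OF bound[OF c], of "real (Suc m)"] by (simp add: mult.assoc)
      finally show ?thesis .
    qed
    then have "0 \<le> h c + real (Suc m) * g c" "0 \<le> real (Suc m) * g c - h c" if "c \<in> C" for c
      using that by (force simp: abs_le_iff simp del: of_nat_Suc)+
    then have "h \<in> order_interval (dual_cone C)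
        (- (real (Suc m) *\<^sub>R g)) (real (Suc m) *\<^sub>R g)"
      unfolding order_interval_def cone_le_def dual_cone_def
      by (simp add: blinfun.diff_left blinfun.add_left blinfun.scaleR_left del: of_nat_Suc)
    then show ?thesis by (intro UN_I[of "Suc m"]) auto
  qed
  then have "(\<Union>n\<in>{1::nat..}. order_interval (dual_cone C) (- (real n *\<^sub>R g)) (real n *\<^sub>R g))
      = UNIV"
    by blast
  with g show ?thesis unfolding quasi_interior_def by simp
qed

theorem corollary3:
  fixes C :: "'a::real_normed_vector set"
  assumes "C \<noteq> {}" and "convex C" and "cone C"
    and "closure {f - g | f g. f \<in> dual_cone C \<and> g \<in> dual_cone C} = UNIV"
    and "point_of_continuity C 0"
  shows "quasi_interior (dual_cone C) \<noteq> {}"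
proof -
  obtain F :: "('a \<Rightarrow>\<^sub>L real) set" and \<delta> where F: "finite F" and \<delta>: "\<delta> > 0"
    and F_bound: "\<And>c. c \<in> C \<Longrightarrow> \<delta> * norm c \<le> (\<Sum>f\<in>F. \<bar>blinfun_apply f c\<bar>)"
    using norm_le_sum_functionals_on_cone[OF assms(3,5)] by metis
  obtain g where g: "g \<in> dual_cone C" and g_bound: "\<And>c. c \<in> C \<Longrightarrow> \<delta> / 2 * norm c \<le> g c"
    using dual_cone_element_dominating_norm[OF assms(4) F \<delta> F_bound] by metis
  have "g \<in> quasi_interior (dual_cone C)"
    using dominating_norm_imp_quasi_interior[OF g _ g_bound] \<delta> by simp
  then show ?thesis by blast
qed

end
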